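(* Let $F$ be a field with a valuation $v$ and valuation ring $O_v$, let $E$ be a finite dimensional (not necessarily commutative) $F$-algebra (with $F\subseteq E$), and let $w$ be a quasi-valuation on $E$ extending $v$. Then $O_w=\{x\in E\mid w(x)\ge0\}$ satisfies LO (lying over) over $O_v$: for every prime ideal $P$ of $O_v$ there is a prime ideal $Q$ of $O_w$ with $Q\cap O_v=P$.
   Context: A totally ordered abelian monoid is a commutative monoid $(M,+)$ with a total order such that $a\le b$ implies $a+c\le b+c$. One adjoins $\infty$, greater than all elements of $M$, with $m+\infty=\infty$. A quasi-valuation on a ring $A$ is a function $w:A\to M\cup\{\infty\}$, $M$ a totally ordered abelian monoid, with $w(0)=\infty$, $w(xy)\ge w(x)+w(y)$ and $w(x+y)\ge\min\{w(x),w(y)\}$ for all $x,y\in A$. $w$ extends $v$ means that the value group $\Gamma_v$ of $v$ is contained in $M$ as an ordered submonoid and $w|_F=v$. A prime ideal of a (possibly noncommutative) ring is a proper two-sided ideal $Q$ such that, for two-sided ideals $A,B$, $AB\subseteq Q$ implies $A\subseteq Q$ or $B\subseteq Q$. *)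

theory Defs
  imports "HOL-Algebra.Algebra" "HOL-Library.Lattice_Constructions"
begin

text \<open>
  For a totally ordered abelian monoid \<open>M\<close>, the set \<open>M \<union> {\<infinity>}\<close> is the library type
  \<^typ>\<open>'m top\<close>, with \<^term>\<open>top.Top\<close> in the role of \<open>\<infinity>\<close>. The library supplies the order;
  only the addition has to be extended, with \<open>m + \<infinity> = \<infinity>\<close>.
\<close>

instantiation top :: (comm_monoid_add) comm_monoid_add
begin

definition zero_top :: "'a top"
  where "0 = top.Value 0"

definition plus_top :: "'a top \<Rightarrow> 'a top \<Rightarrow> 'a top"
  where "x + y = (case x of top.Top \<Rightarrow> top.Top
    | top.Value a \<Rightarrow> (case y of top.Top \<Rightarrow> top.Top | top.Value b \<Rightarrow> top.Value (a + b)))"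

instance
  by standard (auto simp: zero_top_def plus_top_def ac_simps split: top.splits)

end

lemma plus_top_simps [simp]:
  "top.Value a + top.Value b = top.Value (a + b)"
  "top.Top + y = top.Top"
  "y + top.Top = top.Top"
  by (auto simp: plus_top_def split: top.splits)

instance top :: (ordered_comm_monoid_add) ordered_comm_monoid_add
proof
  fix a b c :: "'a top"
  assume "a \<le> b"
  then show "c + a \<le> c + b"
    by (cases a; cases b; cases c) (auto intro: add_left_mono)
qed

locale valuation = field K for K (structure) +
  fixes v :: "'a \<Rightarrow> 'g :: linordered_ab_group_add top"
  assumes val_infty_iff: "x \<in> carrier K \<Longrightarrow> v x = top.Top \<longleftrightarrow> x = \<zero>"
    and val_mult: "\<lbrakk>x \<in> carrier K; y \<in> carrier K\<rbrakk> \<Longrightarrow> v (x \<otimes> y) = v x + v y"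
    and val_add: "\<lbrakk>x \<in> carrier K; y \<in> carrier K\<rbrakk> \<Longrightarrow> v (x \<oplus> y) \<ge> min (v x) (v y)"

locale quasi_valuation = ring A for A (structure) +
  fixes w :: "'a \<Rightarrow> 'm :: {linorder, ordered_comm_monoid_add} top"
  assumes qval_zero: "w \<zero> = top.Top"
    and qval_mult: "\<lbrakk>x \<in> carrier A; y \<in> carrier A\<rbrakk> \<Longrightarrow> w (x \<otimes> y) \<ge> w x + w y"
    and qval_add: "\<lbrakk>x \<in> carrier A; y \<in> carrier A\<rbrakk> \<Longrightarrow> w (x \<oplus> y) \<ge> min (w x) (w y)"

definition value_group :: "('a, 'c) ring_scheme \<Rightarrow> ('a \<Rightarrow> 'g top) \<Rightarrow> 'g set"
  where "value_group K v = {g. \<exists>x\<in>carrier K. v x = top.Value g}"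

text \<open>
  The inclusion of \<open>\<Gamma>\<^sub>v\<close> into \<open>M\<close> as an ordered submonoid is an embedding \<open>\<iota>\<close>, constrained on the
  value group only: \<open>v\<close> need not be onto the ambient type \<^typ>\<open>'g\<close>.
\<close>

definition extends_valuation ::
    "('a, 'c) ring_scheme \<Rightarrow> ('a \<Rightarrow> 'm :: {linorder, ordered_comm_monoid_add} top) \<Rightarrow>
      ('a \<Rightarrow> 'g :: linordered_ab_group_add top) \<Rightarrow> bool"
  where "extends_valuation K w v \<longleftrightarrow>
    (\<exists>\<iota>. \<iota> 0 = 0 \<and>
         (\<forall>a\<in>value_group K v. \<forall>b\<in>value_group K v. \<iota> (a + b) = \<iota> a + \<iota> b) \<and>
         strict_mono_on (value_group K v) \<iota> \<and>
         (\<forall>x\<in>carrier K. w x = map_top \<iota> (v x)))"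

text \<open>Both \<open>O\<^sub>v\<close> and \<open>O\<^sub>w\<close>.\<close>

definition nonneg_ring ::
    "('a, 'c) ring_scheme \<Rightarrow> ('a \<Rightarrow> 'm :: {linorder, ordered_comm_monoid_add} top) \<Rightarrow>
      ('a, 'c) ring_scheme"
  where "nonneg_ring R w = R\<lparr>carrier := {x \<in> carrier R. 0 \<le> w x}\<rparr>"

text \<open>
  Primality in terms of products of two-sided ideals; the library's \<^const>\<open>primeideal\<close> is the
  elementwise notion, restricted to commutative rings.
\<close>

definition nc_primeideal :: "'a set \<Rightarrow> ('a, 'c) ring_scheme \<Rightarrow> bool"
  where "nc_primeideal Q R \<longleftrightarrow> ideal Q R \<and> Q \<noteq> carrier R \<and>
    (\<forall>I J. ideal I R \<longrightarrow> ideal J R \<longrightarrow> I \<cdot>\<^bsub>R\<^esub> J \<subseteq> Q \<longrightarrow> I \<subseteq> Q \<or> J \<subseteq> Q)"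

definition lying_over :: "('a, 'c) ring_scheme \<Rightarrow> ('a, 'c) ring_scheme \<Rightarrow> bool"
  where "lying_over S R \<longleftrightarrow>
    (\<forall>P. nc_primeideal P R \<longrightarrow> (\<exists>Q. nc_primeideal Q S \<and> Q \<inter> carrier R = P))"

lemma (in cring) nc_primeideal_iff_primeideal:
  "nc_primeideal Q R \<longleftrightarrow> primeideal Q R"
proof
  assume Q: "nc_primeideal Q R"
  then interpret ideal Q R by (simp add: nc_primeideal_def)
  have "a \<in> Q \<or> b \<in> Q"
    if ab: "a \<in> carrier R" "b \<in> carrier R" and "a \<otimes> b \<in> Q" for a b
  proof -
    have "x \<in> Q" if "x \<in> (PIdl a) \<cdot> (PIdl b)" for x
      using that
    proof induction
      case (prod i j)
      then obtain r s where "r \<in> carrier R" "s \<in> carrier R" "i = r \<otimes> a" "j = s \<otimes> b"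
        by (auto simp: cgenideal_def)
      moreover from this have "i \<otimes> j = (r \<otimes> s) \<otimes> (a \<otimes> b)"
        using ab by (simp add: m_ac)
      ultimately show ?case
        using \<open>a \<otimes> b \<in> Q\<close> by (simp add: I_l_closed)
    qed simp
    with Q ab have "PIdl a \<subseteq> Q \<or> PIdl b \<subseteq> Q"
      by (auto simp: nc_primeideal_def cgenideal_ideal subset_eq)
    with ab show ?thesis
      using cgenideal_self by blast
  qed
  with Q show "primeideal Q R"
    by (intro primeidealI) (auto simp: nc_primeideal_def is_cring)
next
  assume "primeideal Q R"
  then interpret primeideal Q R .
  have "I \<subseteq> Q \<or> J \<subseteq> Q" if I: "ideal I R" and J: "ideal J R" and "I \<cdot> J \<subseteq> Q" for I J
  proof (rule ccontr)
    assume "\<not> ?thesis"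
    then obtain a b where "a \<in> I" "a \<notin> Q" "b \<in> J" "b \<notin> Q"
      by blast
    with that show False
      using I_prime[of a b] ideal.Icarr[OF I] ideal.Icarr[OF J] ideal_prod.prod[of a I b J R]
      by blast
  qed
  then show "nc_primeideal Q R"
    using I_notcarr by (auto simp: nc_primeideal_def is_ideal)
qed

end

theory Submission
  imports Defs
begin

text \<open>
  The set \<open>O\<^sub>v - P\<close> is multiplicatively closed, and an ideal of \<open>O\<^sub>w\<close> that is maximal among those
  avoiding it is prime. So it suffices to find an ideal of \<open>O\<^sub>w\<close> that contains \<open>P\<close> and avoids
  \<open>O\<^sub>v - P\<close>. As \<open>O\<^sub>v\<close> is a valuation ring, the extension of \<open>P\<close> to \<open>O\<^sub>w\<close> consists of single
  products \<open>p y\<close> with \<open>p \<in> P\<close> and \<open>y \<in> O\<^sub>w\<close>. If such a product is a nonzero element of \<open>O\<^sub>v\<close>,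
  then \<open>y \<in> O\<^sub>w \<inter> F = O\<^sub>v\<close>, whence \<open>p y \<in> P\<close>.
\<close>

text \<open>Negatives are obtained as \<open>\<ominus> a = \<ominus> \<one> \<otimes> a\<close>, so
  absorption of ring elements turns additive closure into a subgroup.\<close>

lemma (in ring) ideal_of_closed:
  assumes sub: "I \<subseteq> carrier R" and ne: "I \<noteq> {}"
    and add: "\<And>a b. \<lbrakk>a \<in> I; b \<in> I\<rbrakk> \<Longrightarrow> a \<oplus> b \<in> I"
    and l: "\<And>a x. \<lbrakk>a \<in> I; x \<in> carrier R\<rbrakk> \<Longrightarrow> x \<otimes> a \<in> I"
    and r: "\<And>a x. \<lbrakk>a \<in> I; x \<in> carrier R\<rbrakk> \<Longrightarrow> a \<otimes> x \<in> I"
  shows "ideal I R"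
proof (rule idealI)
  have minus: "\<ominus> a \<in> I" if "a \<in> I" for a
    using l[OF that, of "\<ominus> \<one>"] sub that by (auto simp: l_minus)
  show "subgroup I (add_monoid R)"
    by (rule group.subgroupI[OF add.is_group]) (use sub ne add minus in \<open>auto simp: a_inv_def\<close>)
qed (use l r ring_axioms in auto)

text \<open>Zorn's lemma yields a maximal \<open>Q\<close>. If neither \<open>A\<close> nor
  \<open>B\<close> lies in \<open>Q\<close>, then both \<open>A + Q\<close> and \<open>B + Q\<close>
  meet \<open>T\<close>; multiplying the two elements found there gives an element of
  \<open>T\<close> inside \<open>A B + Q\<close>, so \<open>A B\<close> cannot lie in
  \<open>Q\<close>.\<close>

lemma (in ring) nc_primeideal_avoiding_exists:
  assumes I: "ideal I R" and T: "T \<subseteq> carrier R" "T \<noteq> {}"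
    and T_mult: "\<And>s t. \<lbrakk>s \<in> T; t \<in> T\<rbrakk> \<Longrightarrow> s \<otimes> t \<in> T"
    and disj: "I \<inter> T = {}"
  shows "\<exists>Q. nc_primeideal Q R \<and> I \<subseteq> Q \<and> Q \<inter> T = {}"
proof -
  define S where "S = {J. ideal J R \<and> I \<subseteq> J \<and> J \<inter> T = {}}"
  have "\<exists>Q\<in>S. \<forall>J\<in>S. Q \<subseteq> J \<longrightarrow> J = Q"
  proof (rule subset_Zorn_nonempty)
    show "S \<noteq> {}" unfolding S_def using I disj by blast
  next
    fix \<C> assume ne: "\<C> \<noteq> {}" and ch: "subset.chain S \<C>"
    then have "subset.chain {J. ideal J R} \<C>"
      by (auto simp: subset_chain_def S_def)
    from chain_Union_is_ideal[OF this] ne have "ideal (\<Union>\<C>) R" by simp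
    moreover have "I \<subseteq> \<Union>\<C>" "\<Union>\<C> \<inter> T = {}"
      using ch ne unfolding subset_chain_def S_def by blast+
    ultimately show "\<Union>\<C> \<in> S" by (simp add: S_def)
  qed
  then obtain Q where QS: "Q \<in> S" and max: "\<forall>J\<in>S. Q \<subseteq> J \<longrightarrow> J = Q" ..
  from QS have Q: "ideal Q R" "I \<subseteq> Q" "Q \<inter> T = {}" by (auto simp: S_def)
  interpret Q: ideal Q R by fact
  \<comment> \<open>The ideal \<open>A <+> Q\<close> properly contains \<open>Q\<close>, so by
    maximality it fails to avoid \<open>T\<close>.\<close>
  have meets: "\<exists>a\<in>A. \<exists>q\<in>Q. a \<oplus> q \<in> T" if A: "ideal A R" and "\<not> A \<subseteq> Q" for A
  proof -
    interpret A: ideal A R by fact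
    have A_sub: "A \<subseteq> A <+> Q"
    proof
      fix a assume "a \<in> A"
      then have "a = a \<oplus> \<zero>" by (simp add: A.Icarr)
      with \<open>a \<in> A\<close> Q.zero_closed show "a \<in> A <+> Q" unfolding set_add_def' by blast
    qed
    have Q_sub: "Q \<subseteq> A <+> Q"
    proof
      fix q assume "q \<in> Q"
      then have "q = \<zero> \<oplus> q" by (simp add: Q.Icarr)
      with \<open>q \<in> Q\<close> A.zero_closed show "q \<in> A <+> Q" unfolding set_add_def' by blast
    qed
    have "A <+> Q \<notin> S"
      using max A_sub Q_sub \<open>\<not> A \<subseteq> Q\<close> by blast
    moreover have "I \<subseteq> A <+> Q" using Q(2) Q_sub by (rule subset_trans)
    ultimately have "(A <+> Q) \<inter> T \<noteq> {}"
      unfolding S_def using add_ideals[OF A Q(1)] by simp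
    then show ?thesis unfolding set_add_def' by blast
  qed
  have "A \<subseteq> Q \<or> B \<subseteq> Q" if A: "ideal A R" and B: "ideal B R" and AB: "A \<cdot> B \<subseteq> Q" for A B
  proof (rule ccontr)
    assume "\<not> ?thesis"
    then obtain a q b r where aq: "a \<in> A" "q \<in> Q" "a \<oplus> q \<in> T"
      and br: "b \<in> B" "r \<in> Q" "b \<oplus> r \<in> T"
      using meets[OF A] meets[OF B] by blast
    have car: "a \<in> carrier R" "q \<in> carrier R" "b \<in> carrier R" "r \<in> carrier R"
      using aq br ideal.Icarr[OF A] ideal.Icarr[OF B] Q.Icarr by auto
    have "a \<otimes> b \<in> Q"
      using AB aq br ideal_prod.prod[of a A b B R] by blast
    moreover have "a \<otimes> r \<in> Q" "q \<otimes> (b \<oplus> r) \<in> Q"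
      using car aq(2) br(2) by (simp_all add: Q.I_l_closed Q.I_r_closed)
    ultimately have "a \<otimes> b \<oplus> a \<otimes> r \<oplus> q \<otimes> (b \<oplus> r) \<in> Q"
      by (intro Q.a_closed)
    \<comment> \<open>The first summand lies in \<open>A B\<close>; each of the others has a factor
      in \<open>Q\<close>.\<close>
    moreover have "(a \<oplus> q) \<otimes> (b \<oplus> r) = a \<otimes> b \<oplus> a \<otimes> r \<oplus> q \<otimes> (b \<oplus> r)"
      using car l_distr[of a q "b \<oplus> r"] r_distr[of b r a] by simp
    ultimately show False
      using T_mult[OF aq(3) br(3)] Q(3) by auto
  qed
  moreover have "Q \<noteq> carrier R" using Q(3) T by blast
  ultimately show ?thesis
    using Q unfolding nc_primeideal_def by blast
qed

text \<open>The axioms of a quasi-valuation bound neither \<open>w \<one>\<close> nor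
  \<open>w (\<ominus> \<one>)\<close> from below. The two assumptions supply the unit and, through
  multiplication by \<open>\<ominus> \<one>\<close>, negatives.\<close>

lemma (in quasi_valuation) nonneg_subring:
  assumes "0 \<le> w \<one>" "0 \<le> w (\<ominus> \<one>)"
  shows "subring {x \<in> carrier A. 0 \<le> w x} A"
proof (rule subringI)
  have mult: "0 \<le> w (x \<otimes> y)"
    if "x \<in> carrier A" "y \<in> carrier A" "0 \<le> w x" "0 \<le> w y" for x y
    using qval_mult[OF that(1,2)] add_nonneg_nonneg[OF that(3,4)] by (rule order_trans[rotated])
  fix x y
  assume x: "x \<in> {x \<in> carrier A. 0 \<le> w x}"
  then have "0 \<le> w (\<ominus> \<one> \<otimes> x)" using assms mult by auto
  then show "\<ominus> x \<in> {x \<in> carrier A. 0 \<le> w x}"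
    using x by (simp add: l_minus)
  assume y: "y \<in> {x \<in> carrier A. 0 \<le> w x}"
  show "x \<otimes> y \<in> {x \<in> carrier A. 0 \<le> w x}" using x y mult by auto
  have "0 \<le> min (w x) (w y)" using x y by simp
  then show "x \<oplus> y \<in> {x \<in> carrier A. 0 \<le> w x}"
    using x y order_trans[OF _ qval_add[of x y]] by auto
qed (use assms in auto)

context valuation
begin

text \<open>A linearly ordered group has no torsion, so \<open>v x + v x = 0\<close> forces
  \<open>v x = 0\<close>. This serves for \<open>\<one>\<close> and
  \<open>\<ominus> \<one>\<close>.\<close>

lemma val_eq_zero_if_square_one:
  assumes "x \<in> carrier K" "x \<otimes> x = \<one>"
  shows "v x = 0"
proof -
  have *: "v \<one> \<noteq> top.Top" by (simp add: val_infty_iff)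
  have "v \<one> + v \<one> = v \<one>" using val_mult[of \<one> \<one>] by simp
  then have v_one: "v \<one> = 0" using * by (cases "v \<one>") (auto simp: zero_top_def)
  have "v x + v x = 0" using val_mult[of x x] assms v_one by simp
  then show ?thesis by (cases "v x") (auto simp: zero_top_def)
qed

lemma val_dvd:
  assumes "a \<in> carrier K" "b \<in> carrier K" "v a \<le> v b"
  obtains c where "c \<in> carrier K" "0 \<le> v c" "b = a \<otimes> c"
proof (cases "a = \<zero>")
  case True
  then have "b = \<zero>" using assms val_infty_iff[of a] val_infty_iff[of b] by (cases "v b") auto
  then show ?thesis using True val_eq_zero_if_square_one[of \<one>] by (intro that[of \<one>]) auto
next
  case False
  let ?c = "inv a \<otimes> b"
  have c: "?c \<in> carrier K" "b = a \<otimes> ?c"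
    using False assms(1,2) field_Units by (auto simp: m_assoc[symmetric])
  \<comment> \<open>Finiteness of \<open>v a\<close> allows it to be cancelled from
    \<open>v a \<le> v a + v ?c\<close>.\<close>
  obtain g where "v a = top.Value g" using False assms val_infty_iff by (cases "v a") auto
  moreover have "v b = v a + v ?c" using c assms val_mult by metis
  ultimately have "0 \<le> v ?c" using assms(3) by (cases "v ?c") (auto simp: zero_top_def)
  then show ?thesis by (rule that[OF c(1) _ c(2)])
qed

end

text \<open>A strictly monotone embedding of a linear order also reflects the order, and 0 is in the
  value group as the value of the unit. The consequence is
  \<open>Ow \<inter> F = Ov\<close>.\<close>

lemma extends_valuation_nonneg_iff:
  assumes "extends_valuation K w v" "valuation K v" "x \<in> carrier K"
  shows "0 \<le> w x \<longleftrightarrow> 0 \<le> v x"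
proof -
  interpret valuation K v by fact
  from assms(1) obtain \<iota> where \<iota>: "\<iota> 0 = 0" "strict_mono_on (value_group K v) \<iota>"
    and w: "w x = map_top \<iota> (v x)"
    using assms(3) unfolding extends_valuation_def by blast
  have 0: "0 \<in> value_group K v"
    using val_eq_zero_if_square_one[of "\<one>\<^bsub>K\<^esub>"]
    by (auto simp: value_group_def zero_top_def intro!: bexI[of _ "\<one>\<^bsub>K\<^esub>"])
  show ?thesis
  proof (cases "v x")
    case (Value g)
    then have "g \<in> value_group K v" using assms(3) by (auto simp: value_group_def)
    then have "\<iota> 0 \<le> \<iota> g \<longleftrightarrow> 0 \<le> g" using strict_mono_on_less_eq[OF \<iota>(2) 0] by blast
    then show ?thesis using Value w \<iota>(1) by (simp add: zero_top_def)
  qed (simp add: w zero_top_def)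
qed

theorem lemma3p12:
  fixes E :: "('a, 'b) ring_scheme" (structure)
    and F :: "'a set"
    and v :: "'a \<Rightarrow> 'g :: linordered_ab_group_add top"
    and w :: "'a \<Rightarrow> 'm :: {linorder, ordered_comm_monoid_add} top"
  assumes "ring E"
    and "subfield F E"
    and "\<And>a x. \<lbrakk>a \<in> F; x \<in> carrier E\<rbrakk> \<Longrightarrow> a \<otimes> x = x \<otimes> a"
    and "ring.finite_dimension E F (carrier E)"
    and "valuation (E\<lparr>carrier := F\<rparr>) v"
    and "quasi_valuation E w"
    and "extends_valuation (E\<lparr>carrier := F\<rparr>) w v"
  shows "lying_over (nonneg_ring E w) (nonneg_ring (E\<lparr>carrier := F\<rparr>) v)"
proof -
  interpret ring E by fact
  note F = subringE[OF subfieldE(1)[OF assms(2)]]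
  note central = assms(3)
  define Ow where "Ow = {x \<in> carrier E. 0 \<le> w x}"
  define Ov where "Ov = {x \<in> F. 0 \<le> v x}"
  have wv: "0 \<le> w x \<longleftrightarrow> 0 \<le> v x" if "x \<in> F" for x
    using extends_valuation_nonneg_iff[OF assms(7,5)] that by simp
  have F_carrier: "x \<in> carrier E" if "x \<in> F" for x using that F(1) by blast
  have Ov_eq: "Ov = Ow \<inter> F" using wv F_carrier by (auto simp: Ov_def Ow_def)
  have units: "\<one> \<in> F" "\<ominus> \<one> \<in> F" "\<ominus> \<one> \<otimes> \<ominus> \<one> = \<one>"
    using F(3,5) by (simp_all add: l_minus)
  \<comment> \<open>Transferred to \<open>w\<close> by \<open>wv\<close>, these values meet the two
    assumptions of \<open>nonneg_subring\<close>.\<close>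
  then have "v \<one> = 0" "v (\<ominus> \<one>) = 0"
    using valuation.val_eq_zero_if_square_one[OF assms(5), of "\<one>"]
      valuation.val_eq_zero_if_square_one[OF assms(5), of "\<ominus> \<one>"] by simp_all
  then have Ow: "subring Ow E"
    unfolding Ow_def using quasi_valuation.nonneg_subring[OF assms(6)] units wv by auto
  note Ow_closed = subringE(3,5,6,7)[OF Ow]
  have Ow_carrier: "x \<in> carrier E" if "x \<in> Ow" for x using that subringE(1)[OF Ow] by blast
  interpret Rw: ring "E\<lparr>carrier := Ow\<rparr>" by (rule subring_is_ring[OF Ow])
  have "subring Ov E" unfolding Ov_eq
    by (rule subringI) (use F_carrier F subringE[OF Ow] in auto)
  then have "subcring Ov E"
    using central F_carrier by (intro subcringI) (auto simp: Ov_def)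
  then have Rv: "cring (E\<lparr>carrier := Ov\<rparr>)"
    by (rule subcring_iff[THEN iffD1, rotated]) (auto simp: Ov_def F_carrier)
  interpret Rv: cring "E\<lparr>carrier := Ov\<rparr>" by fact
  have "\<exists>Q. nc_primeideal Q (E\<lparr>carrier := Ow\<rparr>) \<and> Q \<inter> Ov = P"
    if "nc_primeideal P (E\<lparr>carrier := Ov\<rparr>)" for P
  proof -
    interpret P: primeideal P "E\<lparr>carrier := Ov\<rparr>"
      using that Rv.nc_primeideal_iff_primeideal by blast
    have P_Ov: "p \<in> Ov" if "p \<in> P" for p using P.Icarr[OF that] by simp
    have P_mult: "p \<otimes> c \<in> P" if "p \<in> P" "c \<in> Ov" for p c
      using P.I_r_closed that by simp
    define I where "I = {p \<otimes> y |p y. p \<in> P \<and> y \<in> Ow}"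
    have P_F: "p \<in> F" "p \<in> Ow" if "p \<in> P" for p using P_Ov[OF that] by (auto simp: Ov_eq)
    \<comment> \<open>The element of smaller value divides the other within \<open>Ov\<close>: from
      \<open>q = p \<otimes> c\<close> the sum becomes the single product of \<open>p\<close> with
      \<open>y \<oplus> c \<otimes> z\<close>.\<close>
    have I_add_aux: "p \<otimes> y \<oplus> q \<otimes> z \<in> I"
      if asm: "p \<in> P" "q \<in> P" "y \<in> Ow" "z \<in> Ow" "v p \<le> v q" for p q y z
    proof -
      obtain c where c: "c \<in> F" "0 \<le> v c" "q = p \<otimes> c"
        by (rule valuation.val_dvd[OF assms(5), of p q]) (use asm P_F in auto)
      then have "c \<in> Ow" using Ov_eq unfolding Ov_def by blast
      have "p \<otimes> y \<oplus> q \<otimes> z = p \<otimes> (y \<oplus> c \<otimes> z)"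
        using c(3) \<open>c \<in> Ow\<close> asm P_F(2)[OF asm(1)]
        by (simp add: m_assoc r_distr Ow_carrier)
      moreover have "y \<oplus> c \<otimes> z \<in> Ow" using \<open>c \<in> Ow\<close> asm by (intro Ow_closed)
      ultimately show ?thesis using asm unfolding I_def by blast
    qed
    have I_add: "a \<oplus> b \<in> I" if ab: "a \<in> I" "b \<in> I" for a b
    proof -
      obtain p y q z where *: "p \<in> P" "q \<in> P" "y \<in> Ow" "z \<in> Ow" "a = p \<otimes> y" "b = q \<otimes> z"
        using ab unfolding I_def by blast
      have comm: "p \<otimes> y \<oplus> q \<otimes> z = q \<otimes> z \<oplus> p \<otimes> y"
        by (rule a_comm[OF m_closed[OF Ow_carrier[OF P_F(2)[OF *(1)]] Ow_carrier[OF *(3)]]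
              m_closed[OF Ow_carrier[OF P_F(2)[OF *(2)]] Ow_carrier[OF *(4)]]])
      show ?thesis
      proof (cases "v p \<le> v q")
        case True
        show ?thesis unfolding *(5,6) by (rule I_add_aux[OF *(1-4) True])
      next
        case False
        then have "v q \<le> v p" by simp
        then show ?thesis unfolding *(5,6) comm by (rule I_add_aux[OF *(2,1,4,3)])
      qed
    qed
    have I_Ow: "I \<subseteq> Ow" unfolding I_def using P_F(2) Ow_closed(3) by blast
    have I_l: "x \<otimes> a \<in> I" and I_r: "a \<otimes> x \<in> I" if a: "a \<in> I" and x: "x \<in> Ow" for a x
    proof -
      obtain p y where *: "p \<in> P" "y \<in> Ow" "a = p \<otimes> y" using a unfolding I_def by blast
      note carr = Ow_carrier[OF x] Ow_carrier[OF *(2)] Ow_carrier[OF P_F(2)[OF *(1)]]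
      \<comment> \<open>Absorption on the left relies on \<open>p\<close> being central, as an
        element of \<open>F\<close>.\<close>
      have "x \<otimes> a = p \<otimes> (x \<otimes> y)"
        using carr central[OF P_F(1)[OF *(1)] carr(1)] *(3) by (simp add: m_assoc[symmetric])
      moreover have "a \<otimes> x = p \<otimes> (y \<otimes> x)" using carr *(3) by (simp add: m_assoc)
      moreover have "x \<otimes> y \<in> Ow" "y \<otimes> x \<in> Ow"
        by (rule Ow_closed(3)[OF x *(2)] Ow_closed(3)[OF *(2) x])+
      ultimately show "x \<otimes> a \<in> I" "a \<otimes> x \<in> I" using *(1) unfolding I_def by blast+
    qed
    have P_I: "P \<subseteq> I"
    proof
      fix p assume "p \<in> P"
      then have "p = p \<otimes> \<one>" using r_one[OF Ow_carrier[OF P_F(2)]] by simp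
      then show "p \<in> I" using \<open>p \<in> P\<close> Ow_closed(1) unfolding I_def by blast
    qed
    have I: "ideal I (E\<lparr>carrier := Ow\<rparr>)"
    proof (rule Rw.ideal_of_closed)
      show "I \<subseteq> carrier (E\<lparr>carrier := Ow\<rparr>)" "I \<noteq> {}"
        using I_Ow P_I P.zero_closed by auto
    qed (use I_add I_l I_r in simp_all)
    have I_Ov: "s \<in> P" if "s \<in> I" "s \<in> Ov" for s
    proof -
      obtain p y where *: "p \<in> P" "y \<in> Ow" "s = p \<otimes> y" using \<open>s \<in> I\<close> unfolding I_def by blast
      show ?thesis
      proof (cases "p = \<zero>")
        case True
        then show ?thesis using *(1,3) l_null[OF Ow_carrier[OF *(2)]] by simp
      next
        case False
        have "p \<otimes> y \<in> F" using \<open>s \<in> Ov\<close> *(3) unfolding Ov_eq by blast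
        \<comment> \<open>The nonzero \<open>p\<close> is invertible in \<open>F\<close>, so
          \<open>y\<close> is recovered from \<open>p \<otimes> y\<close> by division in
          \<open>F\<close>.\<close>
        then have "y \<in> F"
          using subfield_m_inv_simprule[OF assms(2) _ Ow_carrier[OF *(2)]] P_F(1)[OF *(1)] False
          by blast
        then show ?thesis using * P_mult Ov_eq by blast
      qed
    qed
    have "\<exists>Q. nc_primeideal Q (E\<lparr>carrier := Ow\<rparr>) \<and> I \<subseteq> Q \<and> Q \<inter> (Ov - P) = {}"
    proof (rule Rw.nc_primeideal_avoiding_exists[OF I])
      show "Ov - P \<subseteq> carrier (E\<lparr>carrier := Ow\<rparr>)" by (auto simp: Ov_eq)
      \<comment> \<open>The complement is nonempty because \<open>P\<close> is proper, and
        multiplicatively closed because \<open>P\<close> is prime elementwise in the commutative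
        ring \<open>Ov\<close>.\<close>
      show "Ov - P \<noteq> {}" using P.I_notcarr P_Ov by auto
      show "s \<otimes>\<^bsub>E\<lparr>carrier := Ow\<rparr>\<^esub> t \<in> Ov - P" if "s \<in> Ov - P" "t \<in> Ov - P" for s t
        using that P.I_prime[of s t] Rv.m_closed[of s t] by auto
      show "I \<inter> (Ov - P) = {}" using I_Ov by blast
    qed
    then obtain Q where "nc_primeideal Q (E\<lparr>carrier := Ow\<rparr>)" "I \<subseteq> Q" "Q \<inter> (Ov - P) = {}"
      by blast
    \<comment> \<open>Avoiding \<open>Ov - P\<close> gives one inclusion, and
      \<open>P \<subseteq> I \<subseteq> Q\<close> the other.\<close>
    moreover from this have "Q \<inter> Ov = P" using P_I P_Ov by blast
    ultimately show ?thesis by blast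
  qed
  then show ?thesis
    by (simp add: lying_over_def nonneg_ring_def Ow_def Ov_def)
qed

end
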